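(* Let $\mathcal{X}\in\mathfrak{Ghol}$ and let $M\in\mathrm{Aut}\,\mathcal{X}$ be an element of Type II. Then $M$ falls into one of the following categories. (1) $\mathfrak{m}_M(x)=x^2-1$ (resp. $x^2+1$), and $M$ is of the form $A_2\,\widetilde{\oplus}\,A_2^{-1}$ (resp. $A_2\,\widetilde{\oplus}\,(-A_2^{-1})$) for some $A_2\in\mathrm{GL}_2(\mathbb{Q})$. (2) $\mathfrak{m}_M(x)=x^4+1$ (resp. $x^4+x^2+1$ or $x^4-x^2+1$), and $M$ is of the form $A_2\,\widetilde{\oplus}\,A_3$ for some $A_2,A_3\in\mathrm{GL}_2(\mathbb{Q})$ satisfying $\mathfrak{m}_{A_2A_3}(x)=x^2+1$ (resp. $x^2+x+1$ or $x^2-x+1$). In this case, the cusp shapes of $\mathcal{X}$ are contained in $\mathbb{Q}(\sqrt{-1})$ when $\mathfrak{m}_M(x)=x^4+1$, and in $\mathbb{Q}(\sqrt{-3})$ when $\mathfrak{m}_M(x)=x^4\pm x^2+1$.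
   Context: Generalized analytic holonomy sets: $\mathfrak{Ghol}$ is the set of analytic sets (germs at $0$) $\mathcal{X}\subset\mathbb{C}^4$, coordinates $(u_1,v_1,u_2,v_2)$, defined by holomorphic functions $v_i(u_1,u_2)=\tau_iu_i+(\text{terms of odd total degree}\ge3)$, $i=1,2$, such that: $\tau_i\in\mathbb{C}\setminus\mathbb{R}$ with $\mathrm{Im}\,\tau_i>0$; $v_1(u_1,0)\ne\tau_1u_1$ and $v_2(0,u_2)\neq\tau_2u_2$ as functions; $v_1$ is odd in $u_1$ and even in $u_2$, $v_2$ is even in $u_1$ and odd in $u_2$; $\frac{\partial v_1}{\partial u_2}=a\frac{\partial v_2}{\partial u_1}$ for some $a\in\mathbb{C}$; every subgroup of $\mathrm{Aut}\,\mathcal{X}$ contained in $\mathrm{GL}_4(\mathbb{Q})$ is finite. The numbers $\tau_1,\tau_2$ are called the cusp shapes of $\mathcal{X}$; standing assumption: they belong to the same quadratic field. A matrix $M\in\mathrm{GL}_4(\mathbb{Q})$ belongs to $\mathrm{Aut}\,\mathcal{X}$ if $\mathbf{x}\mapsto M\mathbf{x}$, $\mathbf{x}=(u_1,v_1,u_2,v_2)^T$, maps (the germ at $0$ of) $\mathcal{X}$ to itself. Write $M\in\mathrm{GL}_4(\mathbb{Q})$ in $2\times2$ blocks as $\begin{pmatrix} A_1 & A_2 \\ A_3 & A_4 \end{pmatrix}$. $M$ is of Type II if $A_1=A_4=0$ and $\det A_2=\det A_3=1$. $A\,\widetilde{\oplus}\,B:=\begin{pmatrix} 0 & A \\ B &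 0 \end{pmatrix}$. $\mathfrak{m}_A(x)$ is the minimal polynomial of $A$ over $\mathbb{Q}$. *)

theory Defs
  imports
    "HOL-Analysis.Analysis"
    "HOL-Computational_Algebra.Polynomial"
    "HOL-Algebra.Group"
begin

section \<open>Block matrices\<close>

text \<open>
  The four coordinates \<open>(u\<^sub>1, v\<^sub>1, u\<^sub>2, v\<^sub>2)\<close> are indexed by the four-element type \<open>2 + 2\<close>,
  so that the \<open>2 \<times> 2\<close> blocks are literally visible: \<open>u\<^sub>1, v\<^sub>1\<close> are the entries \<open>Inl 1, Inl 2\<close>
  and \<open>u\<^sub>2, v\<^sub>2\<close> are the entries \<open>Inr 1, Inr 2\<close>.
\<close>

type_synonym four = "2 + 2"

definition block_matrix ::
  "'a^2^2 \<Rightarrow> 'a^2^2 \<Rightarrow> 'a^2^2 \<Rightarrow> 'a^2^2 \<Rightarrow> 'a^four^four" where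
  "block_matrix A\<^sub>1 A\<^sub>2 A\<^sub>3 A\<^sub>4 =
     (\<chi> i j. case i of
        Inl r \<Rightarrow> (case j of Inl s \<Rightarrow> A\<^sub>1 $ r $ s | Inr s \<Rightarrow> A\<^sub>2 $ r $ s)
      | Inr r \<Rightarrow> (case j of Inl s \<Rightarrow> A\<^sub>3 $ r $ s | Inr s \<Rightarrow> A\<^sub>4 $ r $ s))"

definition cross_sum :: "'a::zero^2^2 \<Rightarrow> 'a^2^2 \<Rightarrow> 'a^four^four" where
  "cross_sum A B = block_matrix 0 A B 0"

definition type_II :: "rat^four^four \<Rightarrow> bool" where
  "type_II M \<longleftrightarrow> (\<exists>A\<^sub>1 A\<^sub>2 A\<^sub>3 A\<^sub>4. M = block_matrix A\<^sub>1 A\<^sub>2 A\<^sub>3 A\<^sub>4 \<and>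
     A\<^sub>1 = 0 \<and> A\<^sub>4 = 0 \<and> det A\<^sub>2 = 1 \<and> det A\<^sub>3 = 1)"


section \<open>Minimal polynomials of matrices\<close>

text \<open>\<open>mat c\<close> is the scalar matrix with diagonal entry \<open>c\<close>; \<open>((**) A ^^ k) (mat 1)\<close> is the
  \<open>k\<close>-th matrix power (the overloaded power and product on vectors are not the matrix ones).\<close>

definition poly_matrix :: "'a::comm_ring_1 poly \<Rightarrow> 'a^'n^'n \<Rightarrow> 'a^'n^'n" where
  "poly_matrix p A = (\<Sum>k\<le>degree p. mat (coeff p k) ** ((**) A ^^ k) (mat 1))"

definition is_min_poly :: "'a::field^'n^'n \<Rightarrow> 'a poly \<Rightarrow> bool" where
  "is_min_poly A p \<longleftrightarrow> lead_coeff p = 1 \<and> poly_matrix p A = 0 \<and>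
     (\<forall>q. q \<noteq> 0 \<longrightarrow> poly_matrix q A = 0 \<longrightarrow> degree p \<le> degree q)"


section \<open>Subfields of the complex numbers\<close>

definition complex_subfield :: "complex set \<Rightarrow> bool" where
  "complex_subfield K \<longleftrightarrow> 0 \<in> K \<and> 1 \<in> K \<and>
     (\<forall>x\<in>K. \<forall>y\<in>K. x + y \<in> K \<and> x * y \<in> K) \<and>
     (\<forall>x\<in>K. - x \<in> K \<and> inverse x \<in> K)"

text \<open>\<open>\<rat>(\<alpha>)\<close>; every subfield of the complex numbers contains the rationals.\<close>

definition rat_adjoin :: "complex \<Rightarrow> complex set" where
  "rat_adjoin \<alpha> = complex_subfield hull {\<alpha>}"

lemma vector_space_rat_complex: "vector_space (\<lambda>(q::rat) (z::complex). of_rat q * z)"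
  by unfold_locales (simp_all add: algebra_simps of_rat_add of_rat_mult)

definition quadratic_field :: "complex set \<Rightarrow> bool" where
  "quadratic_field K \<longleftrightarrow> complex_subfield K \<and>
     vector_space.dim (\<lambda>(q::rat) (z::complex). of_rat q * z) K = 2"


section \<open>Generalized analytic holonomy sets\<close>

text \<open>\<open>v\<close> is holomorphic near the origin, given there by a convergent power series
  \<open>\<alpha> u\<^sub>1 + \<beta> u\<^sub>2 + (terms of odd total degree \<ge> 3)\<close>.\<close>

definition odd_series :: "complex \<Rightarrow> complex \<Rightarrow> (complex \<Rightarrow> complex \<Rightarrow> complex) \<Rightarrow> bool" where
  "odd_series \<alpha> \<beta> v \<longleftrightarrow> (\<exists>c r. r > 0 \<and>
     (\<forall>j k. c j k \<noteq> 0 \<longrightarrow> odd (j + k) \<and> j + k \<ge> 3) \<and>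
     (\<forall>x y. norm x < r \<longrightarrow> norm y < r \<longrightarrow>
        ((\<lambda>(j, k). c j k * x ^ j * y ^ k) has_sum (v x y - (\<alpha> * x + \<beta> * y))) UNIV))"

text \<open>A germ at the origin is represented by any set having that germ. All identities between
  \<open>v\<^sub>1\<close> and \<open>v\<^sub>2\<close> are identities of germs at the origin.\<close>

definition holonomy_presentation ::
  "(complex^four) set \<Rightarrow> complex \<Rightarrow> complex \<Rightarrow>
   (complex \<Rightarrow> complex \<Rightarrow> complex) \<Rightarrow> (complex \<Rightarrow> complex \<Rightarrow> complex) \<Rightarrow> bool" where
  "holonomy_presentation X \<tau>\<^sub>1 \<tau>\<^sub>2 v\<^sub>1 v\<^sub>2 \<longleftrightarrow>
     (\<forall>\<^sub>F x in nhds 0. x \<in> X \<longleftrightarrow>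
        x $ Inl 2 = v\<^sub>1 (x $ Inl 1) (x $ Inr 1) \<and> x $ Inr 2 = v\<^sub>2 (x $ Inl 1) (x $ Inr 1)) \<and>
     odd_series \<tau>\<^sub>1 0 v\<^sub>1 \<and> odd_series 0 \<tau>\<^sub>2 v\<^sub>2 \<and>
     \<tau>\<^sub>1 \<notin> \<real> \<and> Im \<tau>\<^sub>1 > 0 \<and> \<tau>\<^sub>2 \<notin> \<real> \<and> Im \<tau>\<^sub>2 > 0 \<and>
     \<not> (\<forall>\<^sub>F u in nhds 0. v\<^sub>1 u 0 = \<tau>\<^sub>1 * u) \<and>
     \<not> (\<forall>\<^sub>F u in nhds 0. v\<^sub>2 0 u = \<tau>\<^sub>2 * u) \<and>
     (\<forall>\<^sub>F (u\<^sub>1, u\<^sub>2) in nhds (0, 0).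
        v\<^sub>1 (- u\<^sub>1) u\<^sub>2 = - v\<^sub>1 u\<^sub>1 u\<^sub>2 \<and> v\<^sub>1 u\<^sub>1 (- u\<^sub>2) = v\<^sub>1 u\<^sub>1 u\<^sub>2 \<and>
        v\<^sub>2 (- u\<^sub>1) u\<^sub>2 = v\<^sub>2 u\<^sub>1 u\<^sub>2 \<and> v\<^sub>2 u\<^sub>1 (- u\<^sub>2) = - v\<^sub>2 u\<^sub>1 u\<^sub>2) \<and>
     (\<exists>a. \<forall>\<^sub>F (u\<^sub>1, u\<^sub>2) in nhds (0, 0).
        deriv (\<lambda>w. v\<^sub>1 u\<^sub>1 w) u\<^sub>2 = a * deriv (\<lambda>w. v\<^sub>2 w u\<^sub>2) u\<^sub>1)"

definition GL4Q :: "(rat^four^four) monoid" where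
  "GL4Q = \<lparr>carrier = {M. invertible M}, mult = (**), one = mat 1\<rparr>"

definition complex_matrix :: "rat^'n^'m \<Rightarrow> complex^'n^'m" where
  "complex_matrix M = (\<chi> i j. of_rat (M $ i $ j))"

text \<open>Equality of the germs at the origin of the image of \<open>X\<close> under \<open>M\<close> and of \<open>X\<close>.\<close>

definition Aut :: "(complex^four) set \<Rightarrow> (rat^four^four) set" where
  "Aut X = {M \<in> carrier GL4Q.
     \<forall>\<^sub>F x in nhds 0. x \<in> (*v) (complex_matrix M) ` X \<longleftrightarrow> x \<in> X}"

definition Ghol :: "(complex^four) set set" where
  "Ghol = {X. (\<exists>\<tau>\<^sub>1 \<tau>\<^sub>2 v\<^sub>1 v\<^sub>2. holonomy_presentation X \<tau>\<^sub>1 \<tau>\<^sub>2 v\<^sub>1 v\<^sub>2) \<and>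
     (\<forall>H. subgroup H GL4Q \<longrightarrow> H \<subseteq> Aut X \<longrightarrow> finite H)}"

text \<open>The germs of \<open>v\<^sub>1\<close> and \<open>v\<^sub>2\<close>, hence the cusp shapes, are determined by \<open>X\<close>.\<close>

definition cusp_shapes :: "(complex^four) set \<Rightarrow> complex \<Rightarrow> complex \<Rightarrow> bool" where
  "cusp_shapes X \<tau>\<^sub>1 \<tau>\<^sub>2 \<longleftrightarrow> (\<exists>v\<^sub>1 v\<^sub>2. holonomy_presentation X \<tau>\<^sub>1 \<tau>\<^sub>2 v\<^sub>1 v\<^sub>2)"

end

theory Submission
  imports Defs
begin

text \<open>
  \<open>Aut X\<close> is itself a subgroup of \<open>GL\<^sub>4(\<rat>)\<close>, hence finite, so the powers of
  \<open>M\<close> and of the upper left block \<open>A = A\<^sub>2 A\<^sub>3\<close> of its square form finite sets. The traces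
  \<open>x\<^sub>k\<close> of \<open>A\<close> raised to the power \<open>2 ^ k\<close> satisfy \<open>x\<^sub>k\<^sub>+\<^sub>1 = x\<^sub>k\<^sup>2 - 2\<close>, since \<open>det A = 1\<close>; a finite
  rational orbit of this recursion consists of integers in \<open>[-2, 2]\<close>. Trace \<open>\<plusminus>2\<close> makes \<open>\<plusminus>A\<close> unipotent
  and so equal to the identity; in the remaining cases \<open>A\<close> is not scalar and the minimal polynomials
  are read off from the Cayley-Hamilton theorem. Finally \<open>M\<close> preserves the tangent space of \<open>X\<close> at
  the origin, so \<open>(1, \<tau>\<^sub>1)\<close> is an eigenvector of \<open>A\<^sub>2 A\<^sub>3\<close> and \<open>(1, \<tau>\<^sub>2)\<close> one of \<open>A\<^sub>3 A\<^sub>2\<close>,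
  whose eigenvalues generate the field in question.
\<close>

section \<open>Rational 2 by 2 matrices with finitely many powers\<close>

text \<open>A largest orbit value y > 2 would be followed by a larger one, because y^2 - 2 - y = (y
  - 2)(y + 1) > 0. The lower bound then comes from the next value: \<open>x 1\<close> \<le> 2 says
  that the square of \<open>x 0\<close> is at most 4.\<close>

lemma finite_orbit_square_minus_two_le:
  fixes x :: "nat \<Rightarrow> rat"
  assumes rec: "\<And>k. x (Suc k) = (x k)\<^sup>2 - 2" and fin: "finite (range x)"
  shows "\<bar>x 0\<bar> \<le> 2"
proof -
  obtain k where k: "x k = Max (range x)"
    using Max_in[OF fin] by auto
  have max: "x j \<le> x k" for j
    using k fin by simp
  have "x k \<le> 2"
  proof (rule ccontr)
    assume "\<not> x k \<le> 2"
    then have "0 < (x k - 2) * (x k + 1)" by simp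
    also have "\<dots> = x (Suc k) - x k" using rec[of k] by (simp add: power2_eq_square algebra_simps)
    finally show False using max[of "Suc k"] by simp
  qed
  then have le: "x j \<le> 2" for j using max order_trans by blast
  have "(x 0)\<^sup>2 \<le> 2\<^sup>2" using le[of "Suc 0"] rec[of 0] by simp
  then show ?thesis using abs_le_square_iff[of "x 0" 2] by simp
qed

text \<open>Each step squares the denominator, so a finite orbit leaves no room for a denominator
  above 1.\<close>

lemma finite_orbit_square_minus_two_Ints:
  fixes x :: "nat \<Rightarrow> rat"
  assumes rec: "\<And>k. x (Suc k) = (x k)\<^sup>2 - 2" and fin: "finite (range x)"
  shows "x 0 \<in> \<int>"
proof -
  define d where "d k = snd (quotient_of (x k))" for k
  have dpos: "d k > 0" for k
    unfolding d_def by (rule quotient_of_denom_pos')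
  have dSuc: "d (Suc k) = (d k)\<^sup>2" for k
  proof -
    obtain p q where pq: "quotient_of (x k) = (p, q)" by (meson surj_pair)
    have q: "q > 0" and cop: "coprime p q" and xk: "x k = of_int p / of_int q"
      using pq by (auto dest: quotient_of_denom_pos quotient_of_coprime quotient_of_div)
    have "x (Suc k) = of_int (p\<^sup>2 - 2 * q\<^sup>2) / of_int (q\<^sup>2)"
      using q by (simp add: rec xk power_divide field_simps)
    then have "x (Suc k) = Fract (p\<^sup>2 - 2 * q\<^sup>2) (q\<^sup>2)"
      by (simp add: Fract_of_int_quotient)
    \<comment> \<open>The new fraction is already in lowest terms: a common divisor of its numerator
      and denominator divides \<open>p\<^sup>2\<close> as well as \<open>q\<^sup>2\<close>.\<close>
    moreover have "coprime (p\<^sup>2 - 2 * q\<^sup>2) (q\<^sup>2)"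
    proof -
      have "coprime (p\<^sup>2) (q\<^sup>2)" using cop by simp
      moreover have "e dvd p\<^sup>2" if "e dvd p\<^sup>2 - 2 * q\<^sup>2" "e dvd q\<^sup>2" for e
        using dvd_add[OF that(1) dvd_mult[OF that(2), of 2]] by simp
      ultimately show ?thesis by (meson coprime_common_divisor coprimeI)
    qed
    ultimately have "quotient_of (x (Suc k)) = (p\<^sup>2 - 2 * q\<^sup>2, q\<^sup>2)"
      using q by (simp add: quotient_of_Fract Rat.normalize_def Let_def)
    then show ?thesis by (simp add: d_def pq)
  qed
  have "range d = (\<lambda>y. snd (quotient_of y)) ` range x"
    by (auto simp: d_def)
  then have find: "finite (range d)" using fin by simp
  obtain k where k: "d k = Max (range d)"
    using Max_in[OF find] by auto
  have max: "d j \<le> d k" for j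
    using k find by simp
  \<comment> \<open>The square of the largest denominator is again a denominator of the orbit, hence
    no larger than it.\<close>
  have "d k * d k \<le> d k * 1"
    using max[of "Suc k"] dSuc[of k] by (simp add: power2_eq_square)
  then have "d k \<le> 1" using dpos[of k] mult_le_cancel_left_pos by blast
  then have "d 0 = 1" using max[of 0] dpos[of 0] by linarith
  moreover have "x 0 = of_int (fst (quotient_of (x 0))) / of_int (d 0)"
    unfolding d_def by (rule quotient_of_div) simp
  ultimately show ?thesis by (metis Ints_of_int div_by_1 of_int_1)
qed

section \<open>Trace, determinant and powers of 2 by 2 matrices\<close>

abbreviation matpow :: "'a::comm_ring_1^'n^'n \<Rightarrow> nat \<Rightarrow> 'a^'n^'n" where
  "matpow A k \<equiv> ((**) A ^^ k) (mat 1)"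

lemma matpow_add: "matpow A (m + n) = matpow A m ** matpow A n"
  by (induction m) (simp_all add: matrix_mul_assoc)

lemma det_matpow: "det (matpow A k) = det A ^ k"
  by (induction k) (simp_all add: det_mul)

lemma trace_2: "trace (A :: 'a::comm_ring_1^2^2) = A$1$1 + A$2$2"
  by (simp add: trace_def sum_2)

lemma matrix_mult_2:
  fixes A B :: "'a::comm_ring_1^2^2"
  shows "(A ** B) $ i $ j = A$i$1 * B$1$j + A$i$2 * B$2$j"
  by (simp add: matrix_matrix_mult_def sum_2)

text \<open>For determinant 1 this is the recursion x -> x^2 - 2 on traces under squaring.\<close>

lemma trace_square_2:
  fixes A :: "'a::comm_ring_1^2^2"
  shows "trace (A ** A) = (trace A)\<^sup>2 - 2 * det A"
  by (simp add: trace_2 matrix_mult_2 det_2 power2_eq_square algebra_simps)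

lemma mat_eq_iff_2:
  "(A :: 'a^2^2) = B \<longleftrightarrow> A$1$1 = B$1$1 \<and> A$1$2 = B$1$2 \<and> A$2$1 = B$2$1 \<and> A$2$2 = B$2$2"
  by (auto simp: vec_eq_iff forall_2)

lemma cayley_hamilton_2:
  fixes A :: "'a::comm_ring_1^2^2"
  shows "A ** A = mat (trace A) ** A - mat (det A)"
  by (simp add: mat_eq_iff_2 matrix_mult_2 trace_2 det_2 mat_def algebra_simps)

text \<open>The characteristic polynomial is (x - 1)^2, so A = 1 + N with N^2 = 0 and A^k = 1 + kN.
  These powers are pairwise distinct unless N = 0.\<close>

lemma trace_two_imp_mat_1:
  fixes A :: "rat^2^2"
  assumes "det A = 1" "trace A = 2" "finite (range (matpow A))"
  shows "A = mat 1"
proof -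
  have ch: "A ** A = mat 2 ** A - mat 1"
    using cayley_hamilton_2[of A] assms by simp
  \<comment> \<open>The right-hand side is 1 + k(A - 1), that is, x^k reduced modulo (x -
    1)^2.\<close>
  have pow: "matpow A k = mat (of_nat k) ** A - mat (of_nat k - 1)" for k
  proof (induction k)
    case 0
    then show ?case by (simp add: mat_eq_iff_2 matrix_mult_2 mat_def)
  next
    case (Suc k)
    have "matpow A (Suc k) = A ** (mat (of_nat k) ** A - mat (of_nat k - 1))"
      using Suc by simp
    also have "\<dots> = mat (of_nat k) ** (A ** A) - mat (of_nat k - 1) ** A"
      by (simp add: mat_eq_iff_2 matrix_mult_2 mat_def algebra_simps)
    also have "\<dots> = mat (of_nat (Suc k)) ** A - mat (of_nat (Suc k) - 1)"
      unfolding ch by (simp add: mat_eq_iff_2 matrix_mult_2 mat_def algebra_simps)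
    finally show ?case .
  qed
  have "(A - mat 1) $ i $ j = 0" for i j
  proof (rule ccontr)
    assume nz: "(A - mat 1) $ i $ j \<noteq> 0"
    have "inj (matpow A)"
    proof (rule injI)
      fix k l assume "matpow A k = matpow A l"
      then have "(mat (of_nat k) ** A - mat (of_nat k - 1)) $ i $ j
          = (mat (of_nat l) ** A - mat (of_nat l - 1)) $ i $ j"
        using pow by metis
      then have "of_nat k * (A - mat 1) $ i $ j = of_nat l * (A - mat 1) $ i $ j"
        using exhaust_2[of i] exhaust_2[of j]
        by (auto simp: matrix_mult_2 mat_def algebra_simps)
      then show "k = l" using nz by simp
    qed
    then show False using assms(3) finite_imageD infinite_UNIV_nat by blast
  qed
  then show ?thesis by (simp add: vec_eq_iff)
qed

lemma matpow_uminus: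
  fixes A :: "'a::comm_ring_1^2^2"
  shows "matpow (- A) k = mat ((-1) ^ k) ** matpow A k"
  by (induction k) (simp_all add: mat_eq_iff_2 matrix_mult_2 mat_def algebra_simps)

text \<open>Restricting to the exponents \<open>2 ^ k\<close> turns the finite set of powers into a
  finite orbit of the trace recursion. The extreme traces 2 and -2 are settled by the unipotent case
  for \<open>A\<close> and \<open>- A\<close>.\<close>

lemma finite_powers_det_1_cases:
  fixes A :: "rat^2^2"
  assumes det: "det A = 1" and fin: "finite (range (matpow A))"
  shows "A = mat 1 \<or> A = - mat 1 \<or> trace A \<in> {-1, 0, 1}"
proof -
  define x where "x k = trace (matpow A (2 ^ k))" for k
  have rec: "x (Suc k) = (x k)\<^sup>2 - 2" for k
    unfolding x_def by (simp add: mult_2 matpow_add trace_square_2 det_matpow det)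
  have "range x \<subseteq> trace ` range (matpow A)" by (auto simp: x_def)
  then have finx: "finite (range x)" using fin finite_surj by blast
  have x0: "x 0 = trace A" by (simp add: x_def)
  obtain m :: int where m: "trace A = of_int m"
    using finite_orbit_square_minus_two_Ints[OF rec finx] x0 by (auto elim: Ints_cases)
  have "\<bar>m\<bar> \<le> 2"
    using finite_orbit_square_minus_two_le[OF rec finx] unfolding x0 m
    by (metis of_int_abs of_int_le_iff of_int_numeral)
  then have "m \<in> {-2, -1, 0, 1, 2}" by auto
  then consider "trace A = 2" | "trace A = -2" | "trace A \<in> {-1, 0, 1}"
    using m by auto
  then show ?thesis
  proof cases
    case 1
    then show ?thesis using trace_two_imp_mat_1 det fin by blast
  next
    case 2
    \<comment> \<open>Powers of \<open>- A\<close> are powers of \<open>A\<close> up to sign; the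
      two signs are written as products with \<open>mat 1\<close> and \<open>mat (-1)\<close> to
      match \<open>matpow_uminus\<close>.\<close>
    have "range (matpow (- A)) \<subseteq> (\<lambda>B. mat 1 ** B) ` range (matpow A) \<union> (\<lambda>B. mat (-1) ** B) ` range (matpow A)"
      unfolding matpow_uminus
      by (auto simp: minus_one_power_iff)
    then have "finite (range (matpow (- A)))" using fin finite_subset by blast
    moreover have "det (- A) = 1" "trace (- A) = 2" using det 2 by (simp_all add: det_2 trace_2)
    ultimately have "- A = mat 1" using trace_two_imp_mat_1 by blast
    then show ?thesis by (metis minus_minus)
  qed simp
qed

section \<open>Minimal polynomials of block matrices\<close>

lemma block_matrix_nth:
  "block_matrix A\<^sub>1 A\<^sub>2 A\<^sub>3 A\<^sub>4 $ Inl r $ Inl s = A\<^sub>1 $ r $ s"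
  "block_matrix A\<^sub>1 A\<^sub>2 A\<^sub>3 A\<^sub>4 $ Inl r $ Inr s = A\<^sub>2 $ r $ s"
  "block_matrix A\<^sub>1 A\<^sub>2 A\<^sub>3 A\<^sub>4 $ Inr r $ Inl s = A\<^sub>3 $ r $ s"
  "block_matrix A\<^sub>1 A\<^sub>2 A\<^sub>3 A\<^sub>4 $ Inr r $ Inr s = A\<^sub>4 $ r $ s"
  by (simp_all add: block_matrix_def)

lemma sum_four: "(\<Sum>j\<in>(UNIV :: four set). f j) = (\<Sum>s\<in>UNIV. f (Inl s)) + (\<Sum>s\<in>UNIV. f (Inr s))"
  by (subst UNIV_Plus_UNIV[symmetric], subst sum.Plus) simp_all

lemma block_matrix_mult:
  "block_matrix A\<^sub>1 A\<^sub>2 A\<^sub>3 A\<^sub>4 ** block_matrix B\<^sub>1 B\<^sub>2 B\<^sub>3 B\<^sub>4 =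
    block_matrix (A\<^sub>1 ** B\<^sub>1 + A\<^sub>2 ** B\<^sub>3) (A\<^sub>1 ** B\<^sub>2 + A\<^sub>2 ** B\<^sub>4)
      (A\<^sub>3 ** B\<^sub>1 + A\<^sub>4 ** B\<^sub>3) (A\<^sub>3 ** B\<^sub>2 + A\<^sub>4 ** B\<^sub>4)"
  by (simp add: vec_eq_iff split_sum_all matrix_matrix_mult_def sum_four block_matrix_nth)

lemma block_matrix_eq_iff:
  "block_matrix A\<^sub>1 A\<^sub>2 A\<^sub>3 A\<^sub>4 = block_matrix B\<^sub>1 B\<^sub>2 B\<^sub>3 B\<^sub>4 \<longleftrightarrow>
    A\<^sub>1 = B\<^sub>1 \<and> A\<^sub>2 = B\<^sub>2 \<and> A\<^sub>3 = B\<^sub>3 \<and> A\<^sub>4 = B\<^sub>4"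
  by (auto simp: vec_eq_iff split_sum_all block_matrix_nth)

lemma block_matrix_add:
  "block_matrix A\<^sub>1 A\<^sub>2 A\<^sub>3 A\<^sub>4 + block_matrix B\<^sub>1 B\<^sub>2 B\<^sub>3 B\<^sub>4 =
    block_matrix (A\<^sub>1 + B\<^sub>1) (A\<^sub>2 + B\<^sub>2) (A\<^sub>3 + B\<^sub>3) (A\<^sub>4 + B\<^sub>4)"
  by (simp add: vec_eq_iff split_sum_all block_matrix_nth)

lemma mat_block: "mat c = block_matrix (mat c) 0 0 (mat c)"
  by (simp add: vec_eq_iff split_sum_all block_matrix_nth mat_def)

lemma zero_block: "0 = block_matrix 0 0 0 0"
  by (simp add: vec_eq_iff split_sum_all block_matrix_nth)

lemma cross_sum_mult:
  fixes A B C D :: "'a::comm_ring_1^2^2"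
  shows "cross_sum A B ** cross_sum C D = block_matrix (A ** D) 0 0 (B ** C)"
  by (simp add: cross_sum_def block_matrix_mult)

lemma matpow_cross_sum_even:
  fixes A B :: "'a::comm_ring_1^2^2"
  shows "matpow (cross_sum A B) (2 * k) = block_matrix (matpow (A ** B) k) 0 0 (matpow (B ** A) k)"
proof (induction k)
  case 0
  then show ?case by (simp add: mat_block[of 1])
next
  case (Suc k)
  have "matpow (cross_sum A B) (2 * Suc k) = (cross_sum A B ** cross_sum A B) ** matpow (cross_sum A B) (2 * k)"
    by (simp add: matrix_mul_assoc)
  then show ?case unfolding Suc cross_sum_mult by (simp add: block_matrix_mult)
qed

text \<open>The map \<open>h\<close> that extracts the upper left block sends even powers of the
  cross sum onto the powers of \<open>A ** B\<close>.\<close>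

lemma finite_powers_cross_sum:
  fixes A B :: "'a::comm_ring_1^2^2"
  assumes "finite (range (matpow (cross_sum A B)))"
  shows "finite (range (matpow (A ** B)))"
proof -
  define h :: "'a^four^four \<Rightarrow> 'a^2^2" where "h M = (\<chi> r s. M $ Inl r $ Inl s)" for M
  have "matpow (A ** B) k = h (matpow (cross_sum A B) (2 * k))" for k
    by (simp add: matpow_cross_sum_even h_def block_matrix_nth vec_eq_iff)
  then have "range (matpow (A ** B)) \<subseteq> h ` range (matpow (cross_sum A B))" by auto
  then show ?thesis using assms finite_surj by blast
qed

section \<open>Annihilating and minimal polynomials\<close>

lemma mat_mult_nth: "(mat c ** A) $ i $ j = c * A $ i $ j"
  for A :: "'a::comm_ring_1^'n^'m"
proof -
  have "(mat c ** A) $ i $ j = (\<Sum>k\<in>UNIV. if i = k then c * A $ k $ j else 0)"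
    by (simp add: matrix_matrix_mult_def mat_def if_distrib if_distribR cong: if_cong)
  then show ?thesis by simp
qed

text \<open>Lets a polynomial of unknown degree be expanded with a fixed number of terms, as the
  coefficients beyond the degree vanish.\<close>

lemma poly_matrix_altdef:
  assumes "degree p \<le> n"
  shows "poly_matrix p A = (\<Sum>k\<le>n. mat (coeff p k) ** matpow A k)"
proof -
  have "mat (coeff p k) ** matpow A k = 0" if "k \<notin> {..degree p}" for k
    using that by (simp add: vec_eq_iff mat_mult_nth coeff_eq_0)
  then show ?thesis
    unfolding poly_matrix_def using assms by (intro sum.mono_neutral_left) auto
qed

text \<open>If \<open>b\<close> were nonzero, the relation could be solved for \<open>A\<close> as
  the scalar matrix with entry -a/b.\<close>

lemma nonscalar_independent:
  fixes A :: "'a::field^'n^'n"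
  assumes ns: "\<And>c. A \<noteq> mat c" and eq: "mat a + mat b ** A = 0"
  shows "a = 0 \<and> b = 0"
proof -
  have e: "mat a $ i $ j + b * A $ i $ j = 0" for i j
    using arg_cong[OF eq, of "\<lambda>M. M $ i $ j"] by (simp add: mat_mult_nth)
  have "b = 0"
  proof (rule ccontr)
    assume "b \<noteq> 0"
    then have "A $ i $ j = mat (- a / b) $ i $ j" for i j
      using e[of i j] by (auto simp: mat_def field_simps add_eq_0_iff split: if_splits)
    then show False using ns[of "- a / b"] by (simp add: vec_eq_iff)
  qed
  \<comment> \<open>\<open>undefined\<close> stands for an arbitrary index; with b = 0 any diagonal
    entry of the relation gives a = 0.\<close>
  then show ?thesis using e[of undefined undefined] by (simp add: mat_def)
qed

text \<open>A nonzero annihilating polynomial of degree at most 1 would be a linear relation between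
  the identity and \<open>A\<close>. The size is left general so that this serves both 2 by 2 blocks
  and 4 by 4 matrices.\<close>

lemma is_min_poly_quadratic:
  fixes A :: "'a::field^'n^'n"
  assumes ns: "\<And>c. A \<noteq> mat c" and eq: "mat d - mat t ** A + A ** A = 0"
  shows "is_min_poly A [:d, - t, 1:]"
  unfolding is_min_poly_def
proof (intro conjI allI impI)
  have "poly_matrix [:d, - t, 1:] A = mat d - mat t ** A + A ** A"
    by (simp add: poly_matrix_def numeral_2_eq_2 vec_eq_iff mat_mult_nth)
  then show "poly_matrix [:d, - t, 1:] A = 0" using eq by simp
  fix q :: "'a poly" assume q: "q \<noteq> 0" "poly_matrix q A = 0"
  show "degree [:d, - t, 1:] \<le> degree q"
  proof (rule ccontr)
    assume "\<not> ?thesis"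
    then have deg: "degree q \<le> 1" by simp
    then have "mat (coeff q 0) + mat (coeff q 1) ** A = 0"
      using q(2) poly_matrix_altdef[OF deg, of A] by simp
    then have "coeff q 0 = 0 \<and> coeff q 1 = 0" using nonscalar_independent ns by blast
    moreover have "degree q = 0 \<or> degree q = 1" using deg by auto
    ultimately have "lead_coeff q = 0" by (elim disjE) (simp_all only:)
    then show False using q(1) by simp
  qed
qed simp

lemma cayley_hamilton_2_zero:
  fixes A :: "'a::comm_ring_1^2^2"
  shows "mat (det A) - mat (trace A) ** A + A ** A = 0"
  by (simp add: cayley_hamilton_2)

lemma is_min_poly_2:
  fixes A :: "'a::field^2^2"
  assumes "\<And>c. A \<noteq> mat c"
  shows "is_min_poly A [:det A, - trace A, 1:]"
  by (intro is_min_poly_quadratic assms cayley_hamilton_2_zero)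

lemma matrix_add_mult_distrib:
  fixes A B :: "'a::semiring_1^'n^'m" and C :: "'a^'k^'n"
  shows "(A + B) ** C = A ** C + B ** C"
  by (simp add: vec_eq_iff matrix_matrix_mult_def distrib_right sum.distrib)

text \<open>Even powers of a cross sum are block diagonal and odd powers are cross sums, so the even
  and odd parts of \<open>p\<close> land in different blocks.\<close>

lemma poly_matrix_cross_sum:
  fixes A B :: "'a::comm_ring_1^2^2"
  assumes "degree p \<le> 4"
  shows "poly_matrix p (cross_sum A B) =
    block_matrix (mat (coeff p 0) + mat (coeff p 2) ** (A ** B) + mat (coeff p 4) ** ((A ** B) ** (A ** B)))
      ((mat (coeff p 1) + mat (coeff p 3) ** (A ** B)) ** A)
      ((mat (coeff p 1) + mat (coeff p 3) ** (B ** A)) ** B)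
      (mat (coeff p 0) + mat (coeff p 2) ** (B ** A) + mat (coeff p 4) ** ((B ** A) ** (B ** A)))"
proof -
  have eqs: "matpow M (Suc 0) = M" "matpow M 2 = M ** M" "matpow M 3 = M ** (M ** M)"
    "matpow M 4 = M ** (M ** (M ** M))" for M :: "'a^four^four"
    by (simp_all add: eval_nat_numeral)
  have "poly_matrix p (cross_sum A B) = (\<Sum>k\<in>{0,1,2,3,4}. mat (coeff p k) ** matpow (cross_sum A B) k)"
    using poly_matrix_altdef[OF assms, of "cross_sum A B"]
    by (simp add: eval_nat_numeral add.assoc)
  also have "\<dots> = mat (coeff p 0) + mat (coeff p 1) ** cross_sum A B
      + mat (coeff p 2) ** (cross_sum A B ** cross_sum A B)
      + mat (coeff p 3) ** (cross_sum A B ** (cross_sum A B ** cross_sum A B))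
      + mat (coeff p 4) ** (cross_sum A B ** (cross_sum A B ** (cross_sum A B ** cross_sum A B)))"
    unfolding eqs(2-4)[symmetric] by (simp del: funpow.simps add: eqs add.assoc)
  also have "\<dots> = block_matrix (mat (coeff p 0) + mat (coeff p 2) ** (A ** B) + mat (coeff p 4) ** ((A ** B) ** (A ** B)))
      ((mat (coeff p 1) + mat (coeff p 3) ** (A ** B)) ** A)
      ((mat (coeff p 1) + mat (coeff p 3) ** (B ** A)) ** B)
      (mat (coeff p 0) + mat (coeff p 2) ** (B ** A) + mat (coeff p 4) ** ((B ** A) ** (B ** A)))"
    unfolding mat_block[where 'a='a] cross_sum_def block_matrix_mult block_matrix_add block_matrix_eq_iff
    by (simp add: matrix_mul_assoc matrix_add_mult_distrib)
  finally show ?thesis .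
qed

text \<open>The polynomial is the characteristic polynomial of \<open>A ** B\<close> evaluated at
  x^2. It annihilates by Cayley-Hamilton for \<open>A ** B\<close> and \<open>B ** A\<close>, which
  share trace and determinant. For an annihilating polynomial of degree at most 3, the even part
  and, after cancelling \<open>A\<close>, the odd part are linear relations between the identity and
  the nonscalar matrix \<open>A ** B\<close>; hence all its coefficients vanish.\<close>

lemma is_min_poly_cross_sum:
  fixes A B :: "'a::field^2^2"
  assumes ns: "\<And>c. A ** B \<noteq> mat c" and inv: "invertible A"
  shows "is_min_poly (cross_sum A B) [:det (A ** B), 0, - trace (A ** B), 0, 1:]" (is "is_min_poly _ ?p")
  unfolding is_min_poly_def
proof (intro conjI allI impI)
  have BA: "det (B ** A) = det (A ** B)" "trace (B ** A) = trace (A ** B)"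
    by (simp_all add: det_mul mult.commute trace_mul_sym[of B A])
  have ch: "mat (det C) + mat (- trace C) ** C + mat 1 ** (C ** C) = 0" for C :: "'a^2^2"
  proof -
    have "mat (- trace C) ** C = - (mat (trace C) ** C)" by (simp add: vec_eq_iff mat_mult_nth)
    then show ?thesis using cayley_hamilton_2_zero[of C] by simp
  qed
  have z: "mat 0 = (0 :: 'a^2^2)" by (simp add: vec_eq_iff mat_def)
  have c: "coeff ?p 0 = det (A ** B)" "coeff ?p 1 = 0" "coeff ?p 2 = - trace (A ** B)"
    "coeff ?p 3 = 0" "coeff ?p 4 = 1"
    by (simp_all add: eval_nat_numeral)
  have "poly_matrix ?p (cross_sum A B) = block_matrix 0 0 0 0"
    unfolding poly_matrix_cross_sum[of ?p, simplified c, simplified]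
    using ch[of "A ** B"] ch[of "B ** A"] by (simp add: BA z)
  then show "poly_matrix ?p (cross_sum A B) = 0" by (simp add: zero_block)
  fix q :: "'a poly" assume q: "q \<noteq> 0" "poly_matrix q (cross_sum A B) = 0"
  show "degree ?p \<le> degree q"
  proof (rule ccontr)
    assume "\<not> ?thesis"
    then have deg: "degree q \<le> 3" by simp
    then have c4: "coeff q 4 = 0" by (simp add: coeff_eq_0)
    have "block_matrix (mat (coeff q 0) + mat (coeff q 2) ** (A ** B))
      ((mat (coeff q 1) + mat (coeff q 3) ** (A ** B)) ** A)
      ((mat (coeff q 1) + mat (coeff q 3) ** (B ** A)) ** B)
      (mat (coeff q 0) + mat (coeff q 2) ** (B ** A)) = block_matrix 0 0 0 0"
      using poly_matrix_cross_sum[of q A B] deg q(2) by (simp add: c4 z zero_block)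
    then have even: "mat (coeff q 0) + mat (coeff q 2) ** (A ** B) = 0"
      and odd: "(mat (coeff q 1) + mat (coeff q 3) ** (A ** B)) ** A = 0"
      by (simp_all add: block_matrix_eq_iff)
    obtain A' where "A ** A' = mat 1" using inv by (auto simp: invertible_def)
    then have "mat (coeff q 1) + mat (coeff q 3) ** (A ** B) = 0"
      using arg_cong[OF odd, of "\<lambda>C. C ** A'"] by (simp add: matrix_mul_assoc[symmetric])
    then have "coeff q 0 = 0" "coeff q 1 = 0" "coeff q 2 = 0" "coeff q 3 = 0"
      using nonscalar_independent[OF ns even] nonscalar_independent[OF ns] by auto
    moreover have "degree q = 0 \<or> degree q = 1 \<or> degree q = 2 \<or> degree q = 3" using deg by auto
    ultimately have "lead_coeff q = 0" by (elim disjE) (simp_all only:)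
    then show False using q(1) by simp
  qed
qed simp

section \<open>Slopes of eigenvectors\<close>

lemma complex_subfield_of_rat:
  assumes "complex_subfield K"
  shows "of_rat r \<in> K"
proof -
  have nat: "of_nat n \<in> K" for n
    using assms by (induction n) (auto simp: complex_subfield_def)
  have int: "of_int i \<in> K" for i
    using nat assms by (cases i) (auto simp: complex_subfield_def simp del: of_nat_Suc)
  obtain a b where "r = of_int a / of_int b"
    by (metis quotient_of_div surj_pair)
  then have "of_rat r = of_int a * inverse (of_int b :: complex)"
    by (simp add: of_rat_divide divide_inverse[symmetric])
  then show ?thesis
    using int assms by (simp add: complex_subfield_def)
qed

lemma complex_of_rat_in_Reals: "(of_rat r :: complex) \<in> \<real>"
proof -
  obtain a b where "r = of_int a / of_int b"
    by (metis quotient_of_div surj_pair)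
  then show ?thesis by (simp add: of_rat_divide)
qed

text \<open>The equation \<open>eq\<close> says that (1, \<tau>) is an eigenvector of
  \<open>A\<close>. It is quadratic in \<tau> over the rationals, with the discriminant of the
  characteristic polynomial of \<open>A\<close>; the factor \<open>k\<close> absorbs a rational
  square in that discriminant.\<close>

lemma eigenvector_slope_in_rat_adjoin:
  fixes A :: "rat^2^2" and \<tau> \<delta> :: complex
  assumes ns: "\<And>c. A \<noteq> mat c" and \<tau>: "\<tau> \<notin> \<real>"
    and eq: "of_rat (A$2$1) + of_rat (A$2$2) * \<tau> = \<tau> * (of_rat (A$1$1) + of_rat (A$1$2) * \<tau>)"
    and \<delta>: "(of_rat k * \<delta>)\<^sup>2 = of_rat ((trace A)\<^sup>2 - 4 * det A)"
  shows "\<tau> \<in> rat_adjoin \<delta>"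
proof -
  define p q r s where "p = A$1$1" and "q = A$1$2" and "r = A$2$1" and "s = A$2$2"
  note defs = p_def q_def r_def s_def
  \<comment> \<open>Without its quadratic term the equation either makes \<tau> rational or forces p
    = s and r = 0, which makes \<open>A\<close> scalar.\<close>
  have "q \<noteq> 0"
  proof
    assume q: "q = 0"
    have ps: "p = s"
    proof (rule ccontr)
      assume "p \<noteq> s"
      then have "\<tau> = of_rat (r / (p - s))"
        using eq q by (simp add: defs of_rat_divide of_rat_diff field_simps)
      then show False using \<tau> complex_of_rat_in_Reals by metis
    qed
    then have "r = 0" using eq q by (simp add: defs)
    then have "A = mat p" using q ps by (simp add: mat_eq_iff_2 mat_def defs)
    then show False using ns by blast
  qed
  have quad: "of_rat q * \<tau>\<^sup>2 = of_rat r + (of_rat s - of_rat p) * \<tau>"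
    using eq by (simp add: defs power2_eq_square algebra_simps)
  \<comment> \<open>Completing the square in the quadratic equation for \<tau>.\<close>
  have "(2 * of_rat q * \<tau> + of_rat p - of_rat s)\<^sup>2
    = 4 * of_rat q * (of_rat q * \<tau>\<^sup>2) + 4 * of_rat q * \<tau> * (of_rat p - of_rat s) + (of_rat p - of_rat s)\<^sup>2"
    by (simp add: power2_eq_square algebra_simps)
  also have "\<dots> = of_rat ((trace A)\<^sup>2 - 4 * det A)"
    unfolding quad by (simp add: trace_2 det_2 defs[symmetric] of_rat_diff of_rat_add of_rat_mult of_rat_power power2_eq_square algebra_simps)
  finally have "(2 * of_rat q * \<tau> + of_rat p - of_rat s)\<^sup>2 = (of_rat k * \<delta>)\<^sup>2"
    using \<delta> by simp
  then have "2 * of_rat q * \<tau> + of_rat p - of_rat s = of_rat k * \<delta>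
      \<or> 2 * of_rat q * \<tau> + of_rat p - of_rat s = - (of_rat k * \<delta>)"
    by (simp add: power2_eq_iff)
  \<comment> \<open>\<open>e\<close> is \<open>k\<close> or \<open>- k\<close>, which merges the two
    signs of the square root.\<close>
  then obtain e :: rat where "2 * of_rat q * \<tau> + of_rat p - of_rat s = of_rat e * \<delta>"
    by (metis mult_minus_left of_rat_minus)
  then have \<tau>_eq: "\<tau> = of_rat ((s - p) / (2 * q)) + of_rat (e / (2 * q)) * \<delta>"
    using \<open>q \<noteq> 0\<close> by (simp add: of_rat_divide of_rat_diff of_rat_mult field_simps)
  have "\<tau> \<in> K" if "complex_subfield K" "\<delta> \<in> K" for K
    using that complex_subfield_of_rat[OF that(1)] unfolding \<tau>_eq
    by (simp add: complex_subfield_def)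
  then show ?thesis by (auto simp: rat_adjoin_def hull_def)
qed

section \<open>The tangent space and the automorphism group\<close>

lemma norm_power_le_square_scale:
  fixes x y :: complex
  assumes "norm x \<le> m" "norm y \<le> m" "m \<le> \<rho>" "\<rho> > 0" "j + k \<ge> 2"
  shows "norm (x ^ j * y ^ k) \<le> \<rho> ^ (j + k) * (m / \<rho>)\<^sup>2"
proof -
  have m0: "0 \<le> m" using assms(1) norm_ge_zero order_trans by blast
  have "norm (x ^ j * y ^ k) = norm x ^ j * norm y ^ k" by (simp add: norm_mult norm_power)
  also have "\<dots> \<le> m ^ j * m ^ k"
    using assms(1,2) m0 by (intro mult_mono power_mono) auto
  also have "\<dots> = \<rho> ^ (j + k) * (m / \<rho>) ^ (j + k)"
    using assms(4) by (simp add: power_divide power_add)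
  also have "\<dots> \<le> \<rho> ^ (j + k) * (m / \<rho>)\<^sup>2"
    using assms m0 by (intro mult_left_mono power_decreasing) auto
  finally show ?thesis .
qed

text \<open>The remainder is dominated termwise by the absolutely convergent series at (\<rho>,
  \<rho>). All its monomials have degree at least 2, so each gains a factor of at most
  (m/\<rho>)^2.\<close>

lemma odd_series_quadratic_bound:
  assumes "odd_series \<alpha> \<beta> v"
  shows "\<exists>\<rho> C. \<rho> > 0 \<and> (\<forall>x y m. norm x \<le> m \<longrightarrow> norm y \<le> m \<longrightarrow> m \<le> \<rho> \<longrightarrow>
    norm (v x y - (\<alpha> * x + \<beta> * y)) \<le> C * m\<^sup>2)"
proof -
  obtain c r where r: "r > 0" and cr: "\<forall>j k. c j k \<noteq> 0 \<longrightarrow> odd (j + k) \<and> j + k \<ge> 3"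
    "\<forall>x y. norm x < r \<longrightarrow> norm y < r \<longrightarrow>
        ((\<lambda>(j, k). c j k * x ^ j * y ^ k) has_sum (v x y - (\<alpha> * x + \<beta> * y))) UNIV"
    using assms unfolding odd_series_def by blast
  note c = cr(1)[rule_format] and sums = cr(2)[rule_format]
  \<comment> \<open>Halving keeps the comparison point (\<rho>, \<rho>) strictly inside the polydisc
    of convergence.\<close>
  define \<rho> where "\<rho> = r / 2"
  have \<rho>: "\<rho> > 0" "\<rho> < r" using r by (auto simp: \<rho>_def)
  define g where "g = (\<lambda>(j, k). norm (c j k) * \<rho> ^ (j + k))"
  have "(\<lambda>(j, k). c j k * complex_of_real \<rho> ^ j * complex_of_real \<rho> ^ k) summable_on UNIV"
    using sums[of "of_real \<rho>" "of_real \<rho>"] \<rho> by (auto simp: summable_on_def)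
  then have "(\<lambda>p. norm ((\<lambda>(j, k). c j k * complex_of_real \<rho> ^ j * complex_of_real \<rho> ^ k) p)) summable_on UNIV"
    using summable_on_iff_abs_summable_on_complex by blast
  also have "(\<lambda>p. norm ((\<lambda>(j, k). c j k * complex_of_real \<rho> ^ j * complex_of_real \<rho> ^ k) p)) = g"
    using \<rho> by (auto simp: g_def fun_eq_iff norm_mult norm_power power_add)
  finally have g: "g summable_on UNIV" .
  define S where "S = infsum g UNIV"
  have S: "(g has_sum S) UNIV" using g by (simp add: S_def)
  show ?thesis
  proof (intro exI conjI allI impI)
    show "\<rho> > 0" using \<rho>(1) .
    fix x y :: complex and m assume m: "norm x \<le> m" "norm y \<le> m" "m \<le> \<rho>"
    have "norm (v x y - (\<alpha> * x + \<beta> * y)) \<le> S * (m / \<rho>)\<^sup>2"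
    proof (rule norm_infsum_le)
      show "((\<lambda>(j, k). c j k * x ^ j * y ^ k) has_sum (v x y - (\<alpha> * x + \<beta> * y))) UNIV"
        using sums m \<rho> by auto
      show "((\<lambda>p. g p * (m / \<rho>)\<^sup>2) has_sum S * (m / \<rho>)\<^sup>2) UNIV"
        using S by (rule has_sum_cmult_left)
      fix p :: "nat \<times> nat"
      obtain j k where p: "p = (j, k)" by (cases p)
      show "norm (case p of (j, k) \<Rightarrow> c j k * x ^ j * y ^ k) \<le> g p * (m / \<rho>)\<^sup>2"
      proof (cases "c j k = 0")
        case False
        then have "norm (x ^ j * y ^ k) \<le> \<rho> ^ (j + k) * (m / \<rho>)\<^sup>2"
          using c[of j k] m \<rho> by (intro norm_power_le_square_scale) auto
        then show ?thesis
          by (simp add: p g_def norm_mult mult.assoc mult_left_mono)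
      qed (simp add: p g_def)
    qed
    then show "norm (v x y - (\<alpha> * x + \<beta> * y)) \<le> S / \<rho>\<^sup>2 * m\<^sup>2"
      by (simp add: power_divide)
  qed
qed

text \<open>Along a curve leaving the origin with velocity (p, q), the quadratic remainder divided
  by s is of order s, so only the linear part survives.\<close>

lemma odd_series_tendsto:
  fixes x y :: "real \<Rightarrow> complex"
  assumes v: "odd_series \<alpha> \<beta> v"
    and x: "((\<lambda>s. x s / of_real s) \<longlongrightarrow> p) (at_right 0)"
    and y: "((\<lambda>s. y s / of_real s) \<longlongrightarrow> q) (at_right 0)"
  shows "((\<lambda>s. v (x s) (y s) / of_real s) \<longlongrightarrow> \<alpha> * p + \<beta> * q) (at_right 0)"
proof -
  obtain \<rho> C where \<rho>: "\<rho> > 0" and bounds: "\<forall>x y m. norm x \<le> m \<longrightarrow> norm y \<le> m \<longrightarrow> m \<le> \<rho> \<longrightarrow>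
    norm (v x y - (\<alpha> * x + \<beta> * y)) \<le> C * m\<^sup>2"
    using odd_series_quadratic_bound[OF v] by blast
  note bd = bounds[rule_format]
  \<comment> \<open>\<open>B\<close> strictly exceeds both limiting norms, so eventually
    \<open>x s\<close> and \<open>y s\<close> have norm below \<open>B * s\<close>; the remainder
    bound is then used with m = \<open>B * s\<close>.\<close>
  define B where "B = norm p + norm q + 1"
  have B: "B > 0" "norm p < B" "norm q < B" unfolding B_def
    by (simp_all add: add_nonneg_pos add.assoc)
  have ev: "\<forall>\<^sub>F s in at_right 0. norm (v (x s) (y s) / of_real s - (\<alpha> * (x s / of_real s) + \<beta> * (y s / of_real s))) \<le> C * B\<^sup>2 * s"
  proof -
    have 1: "\<forall>\<^sub>F s in at_right 0. norm (x s / of_real s) < B"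
      using tendsto_norm[OF x] B(2) by (rule order_tendstoD)
    have 2: "\<forall>\<^sub>F s in at_right 0. norm (y s / of_real s) < B"
      using tendsto_norm[OF y] B(3) by (rule order_tendstoD)
    have 3: "\<forall>\<^sub>F s in at_right (0::real). 0 < s \<and> s < \<rho> / B"
      using \<rho> B by (auto simp: eventually_at_right intro!: exI[of _ "\<rho> / B"])
    from 1 2 3 show ?thesis
    proof eventually_elim
      case (elim s)
      then have s: "s > 0" by simp
      have "norm (v (x s) (y s) - (\<alpha> * x s + \<beta> * y s)) \<le> C * (B * s)\<^sup>2"
        using elim s B by (intro bd) (auto simp: norm_divide field_simps)
      then have "norm (v (x s) (y s) - (\<alpha> * x s + \<beta> * y s)) / s \<le> C * B\<^sup>2 * s"
        using s by (simp add: field_simps power2_eq_square)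
      also have "norm (v (x s) (y s) - (\<alpha> * x s + \<beta> * y s)) / s
        = norm ((v (x s) (y s) - (\<alpha> * x s + \<beta> * y s)) / of_real s)"
        using s by (simp add: norm_divide)
      also have "(v (x s) (y s) - (\<alpha> * x s + \<beta> * y s)) / of_real s
        = v (x s) (y s) / of_real s - (\<alpha> * (x s / of_real s) + \<beta> * (y s / of_real s))"
        by (simp add: diff_divide_distrib add_divide_distrib)
      finally show ?case .
    qed
  qed
  have "((\<lambda>s. C * B\<^sup>2 * s) \<longlongrightarrow> C * B\<^sup>2 * 0) (at_right 0)"
    by (intro tendsto_intros)
  then have "((\<lambda>s. v (x s) (y s) / of_real s - (\<alpha> * (x s / of_real s) + \<beta> * (y s / of_real s))) \<longlongrightarrow> 0) (at_right 0)"
    using Lim_null_comparison[OF ev] by simp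
  from tendsto_add[OF this tendsto_add[OF tendsto_mult_left[OF x, of \<alpha>] tendsto_mult_left[OF y, of \<beta>]]]
  show ?thesis by simp
qed

section \<open>Automorphisms of the germ as a subgroup of GL_4(Q)\<close>

lemma complex_matrix_mult: "complex_matrix (M ** N) = complex_matrix M ** complex_matrix N"
  by (simp add: complex_matrix_def matrix_matrix_mult_def vec_eq_iff of_rat_sum of_rat_mult)

lemma complex_matrix_1: "complex_matrix (mat 1) = mat 1"
  by (simp add: complex_matrix_def mat_def vec_eq_iff)

lemma tendsto_matrix_vector_mult:
  fixes A :: "complex^'n^'m"
  assumes "(f \<longlongrightarrow> l) F"
  shows "((\<lambda>t. A *v f t) \<longlongrightarrow> A *v l) F"
  unfolding matrix_vector_mult_def
  by (intro tendsto_vec_lambda tendsto_sum tendsto_mult tendsto_const tendsto_vec_nth assms)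

text \<open>Linear maps are continuous and fix the origin, so statements about germs there can be
  pulled back along them.\<close>

lemma eventually_matrix_vector_mult_nhds_0:
  fixes A :: "complex^'n^'m"
  assumes "\<forall>\<^sub>F x in nhds 0. P x"
  shows "\<forall>\<^sub>F x in nhds 0. P (A *v x)"
proof -
  have "((\<lambda>x. A *v x) \<longlongrightarrow> A *v 0) (nhds 0)"
    by (intro tendsto_matrix_vector_mult filterlim_ident)
  then show ?thesis using assms by (simp add: filterlim_iff)
qed

lemma complex_matrix_inverse:
  assumes "M ** N = mat 1"
  shows "complex_matrix M *v (complex_matrix N *v x) = x"
  using assms by (simp add: matrix_vector_mul_assoc complex_matrix_mult[symmetric] complex_matrix_1)

text \<open>Replaces the image of \<open>X\<close> under \<open>M\<close> by the preimage under the
  inverse \<open>N\<close>, a form that composes by substitution.\<close>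

lemma Aut_iff_inverse:
  assumes "M ** N = mat 1" "N ** M = mat 1"
  shows "M \<in> Aut X \<longleftrightarrow> (\<forall>\<^sub>F x in nhds 0. complex_matrix N *v x \<in> X \<longleftrightarrow> x \<in> X)"
proof -
  have "x \<in> (*v) (complex_matrix M) ` X \<longleftrightarrow> complex_matrix N *v x \<in> X" for x
    using complex_matrix_inverse[OF assms(1)] complex_matrix_inverse[OF assms(2)]
    by (metis image_iff)
  moreover have "invertible M" using assms by (auto simp: invertible_def)
  ultimately show ?thesis by (simp add: Aut_def GL4Q_def)
qed

lemma Aut_inverse:
  assumes MN: "M ** N = mat 1" "N ** M = mat 1" and M: "M \<in> Aut X"
  shows "N \<in> Aut X"
proof -
  have "\<forall>\<^sub>F x in nhds 0. complex_matrix N *v x \<in> X \<longleftrightarrow> x \<in> X"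
    using M Aut_iff_inverse[OF MN] by simp
  from eventually_matrix_vector_mult_nhds_0[OF this, of "complex_matrix M"]
  have "\<forall>\<^sub>F x in nhds 0. complex_matrix M *v x \<in> X \<longleftrightarrow> x \<in> X"
    by (simp add: complex_matrix_inverse[OF MN(2)] eq_commute)
  then show ?thesis using Aut_iff_inverse[OF MN(2,1)] by simp
qed

lemma Aut_invertibleE:
  assumes "M \<in> Aut X"
  obtains N where "M ** N = mat 1" "N ** M = mat 1"
  using assms by (auto simp: Aut_def GL4Q_def invertible_def)

lemma Aut_mult:
  assumes M: "M \<in> Aut X" and M': "M' \<in> Aut X"
  shows "M ** M' \<in> Aut X"
proof -
  obtain N where N: "M ** N = mat 1" "N ** M = mat 1" using M by (rule Aut_invertibleE)
  obtain N' where N': "M' ** N' = mat 1" "N' ** M' = mat 1" using M' by (rule Aut_invertibleE)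
  have "(M ** M') ** (N' ** N) = M ** (M' ** N') ** N"
    by (simp only: matrix_mul_assoc)
  then have 1: "(M ** M') ** (N' ** N) = mat 1" by (simp add: N N')
  have "(N' ** N) ** (M ** M') = N' ** (N ** M) ** M'"
    by (simp only: matrix_mul_assoc)
  then have 2: "(N' ** N) ** (M ** M') = mat 1" by (simp add: N N')
  have ev: "\<forall>\<^sub>F x in nhds 0. complex_matrix N *v x \<in> X \<longleftrightarrow> x \<in> X"
    using M Aut_iff_inverse[OF N] by simp
  have "\<forall>\<^sub>F x in nhds 0. complex_matrix N' *v x \<in> X \<longleftrightarrow> x \<in> X"
    using M' Aut_iff_inverse[OF N'] by simp
  from eventually_matrix_vector_mult_nhds_0[OF this, of "complex_matrix N"] ev
  have "\<forall>\<^sub>F x in nhds 0. complex_matrix (N' ** N) *v x \<in> X \<longleftrightarrow> x \<in> X"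
    by eventually_elim (simp add: complex_matrix_mult matrix_vector_mul_assoc)
  then show ?thesis using Aut_iff_inverse[OF 1 2] by simp
qed

lemma Aut_mat_1: "mat 1 \<in> Aut X"
  by (simp add: Aut_iff_inverse[of _ "mat 1"] complex_matrix_1)

lemma group_GL4Q: "group GL4Q"
proof (rule groupI)
  fix M assume "M \<in> carrier GL4Q"
  then obtain N where "M ** N = mat 1" "N ** M = mat 1"
    by (auto simp: GL4Q_def invertible_def)
  then show "\<exists>N\<in>carrier GL4Q. N \<otimes>\<^bsub>GL4Q\<^esub> M = \<one>\<^bsub>GL4Q\<^esub>"
    by (intro bexI[of _ N]) (auto simp: GL4Q_def invertible_def)
next
  show "\<one>\<^bsub>GL4Q\<^esub> \<in> carrier GL4Q"
    by (auto simp: GL4Q_def invertible_def intro: exI[of _ "mat 1"])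
qed (auto simp: GL4Q_def invertible_mult matrix_mul_assoc)

text \<open>This makes the finiteness clause of \<open>Ghol\<close> applicable to
  \<open>Aut X\<close> itself.\<close>

lemma subgroup_Aut: "subgroup (Aut X) GL4Q"
proof
  show "Aut X \<subseteq> carrier GL4Q" by (auto simp: Aut_def)
  show "\<one>\<^bsub>GL4Q\<^esub> \<in> Aut X" using Aut_mat_1 by (simp add: GL4Q_def)
next
  fix M M' assume "M \<in> Aut X" "M' \<in> Aut X"
  then show "M \<otimes>\<^bsub>GL4Q\<^esub> M' \<in> Aut X" using Aut_mult by (simp add: GL4Q_def)
next
  fix M assume M: "M \<in> Aut X"
  then obtain N where N: "M ** N = mat 1" "N ** M = mat 1" by (rule Aut_invertibleE)
  then have "inv\<^bsub>GL4Q\<^esub> M = N"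
    by (intro group.inv_equality[OF group_GL4Q]) (auto simp: GL4Q_def invertible_def)
  then show "inv\<^bsub>GL4Q\<^esub> M \<in> Aut X" using Aut_inverse[OF N M] by simp
qed

lemma finite_Aut: "X \<in> Ghol \<Longrightarrow> finite (Aut X)"
  using subgroup_Aut by (auto simp: Ghol_def)

section \<open>Action on the tangent space at the origin\<close>

text \<open>A curve on \<open>X\<close> with velocity \<open>w\<close> is carried by
  \<open>M\<close> to a curve that stays on \<open>X\<close> near the origin. Dividing the equations
  of \<open>X\<close> along the image by s and letting s tend to 0 leaves the linearised equations
  for the image of \<open>w\<close>.\<close>

lemma Aut_preserves_tangent_space:
  fixes w :: "complex^four"
  assumes M: "M \<in> Aut X" and X: "holonomy_presentation X \<tau>\<^sub>1 \<tau>\<^sub>2 v\<^sub>1 v\<^sub>2"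
    and w: "w $ Inl 2 = \<tau>\<^sub>1 * w $ Inl 1" "w $ Inr 2 = \<tau>\<^sub>2 * w $ Inr 1"
  shows "(complex_matrix M *v w) $ Inl 2 = \<tau>\<^sub>1 * (complex_matrix M *v w) $ Inl 1"
    and "(complex_matrix M *v w) $ Inr 2 = \<tau>\<^sub>2 * (complex_matrix M *v w) $ Inr 1"
proof -
  let ?C = "complex_matrix M"
  have X_iff: "\<forall>\<^sub>F x in nhds 0. x \<in> X \<longleftrightarrow>
        x $ Inl 2 = v\<^sub>1 (x $ Inl 1) (x $ Inr 1) \<and> x $ Inr 2 = v\<^sub>2 (x $ Inl 1) (x $ Inr 1)"
    and v1: "odd_series \<tau>\<^sub>1 0 v\<^sub>1" and v2: "odd_series 0 \<tau>\<^sub>2 v\<^sub>2"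
    using X by (auto simp: holonomy_presentation_def)
  obtain N where N: "M ** N = mat 1" "N ** M = mat 1" using M by (rule Aut_invertibleE)
  \<comment> \<open>The preimage criterion, applied to the automorphism \<open>N\<close>, involves
    \<open>M\<close> itself in the forward direction.\<close>
  have X_inv: "\<forall>\<^sub>F x in nhds 0. ?C *v x \<in> X \<longleftrightarrow> x \<in> X"
    using Aut_inverse[OF N M] Aut_iff_inverse[OF N(2,1)] by simp
  define p q where "p = w $ Inl 1" and "q = w $ Inr 1"
  define u where "u z s = of_real s * z" for z :: complex and s :: real
  \<comment> \<open>\<open>y\<close> is a curve on \<open>X\<close> through the origin with tangent vector \<open>w\<close>.\<close>
  define y :: "real \<Rightarrow> complex^four" where
    "y s = (\<chi> i. case i of
        Inl r \<Rightarrow> if r = 1 then u p s else v\<^sub>1 (u p s) (u q s)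
      | Inr r \<Rightarrow> if r = 1 then u q s else v\<^sub>2 (u p s) (u q s))" for s
  define g where "g s = (\<chi> i. y s $ i / of_real s)" for s
  have pos: "\<forall>\<^sub>F s in at_right (0::real). s > 0"
    by (simp add: eventually_at_right_less)
  have u: "((\<lambda>s. u z s / of_real s) \<longlongrightarrow> z) (at_right 0)" for z
    by (rule tendsto_eventually, rule eventually_mono[OF pos]) (simp add: u_def)
  \<comment> \<open>The vanishing summands are kept, and \<open>mult_zero_left\<close> is switched
    off below, so that the limits have the form produced by
    \<open>odd_series_tendsto\<close>.\<close>
  have w_eq: "w = (\<chi> i. case i of
        Inl r \<Rightarrow> if r = 1 then p else \<tau>\<^sub>1 * p + 0 * q
      | Inr r \<Rightarrow> if r = 1 then q else 0 * p + \<tau>\<^sub>2 * q)"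
    using w exhaust_2 by (auto simp: vec_eq_iff p_def q_def split: sum.split)
  have g: "(g \<longlongrightarrow> w) (at_right 0)"
  proof (rule vec_tendstoI)
    fix i :: four
    show "((\<lambda>s. g s $ i) \<longlongrightarrow> w $ i) (at_right 0)"
      unfolding w_eq g_def y_def
      using u odd_series_tendsto[OF v1 u u, of p q] odd_series_tendsto[OF v2 u u, of p q]
      by (cases i) (auto simp del: mult_zero_left)
  qed
  have Cg: "((\<lambda>s. (?C *v g s) $ i) \<longlongrightarrow> (?C *v w) $ i) (at_right 0)" for i
    by (intro tendsto_vec_nth tendsto_matrix_vector_mult g)
  have y_g: "\<forall>\<^sub>F s in at_right 0. y s = of_real s *s g s"
    using pos by eventually_elim (simp add: g_def vec_eq_iff)
  have Cy_g: "\<forall>\<^sub>F s in at_right 0. (?C *v y s) $ i / of_real s = (?C *v g s) $ i" for i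
    using y_g pos by eventually_elim (simp add: matrix_vector_mult_def sum_divide_distrib)
  have Cy: "((\<lambda>s. (?C *v y s) $ i / of_real s) \<longlongrightarrow> (?C *v w) $ i) (at_right 0)" for i
    using Cg[of i] tendsto_cong[OF Cy_g] by simp
  have "((\<lambda>s. of_real s *s g s) \<longlongrightarrow> 0) (at_right 0)"
  proof (rule vec_tendstoI)
    fix i :: four
    have "((\<lambda>s. of_real s * g s $ i) \<longlongrightarrow> of_real 0 * w $ i) (at_right 0)"
      by (intro tendsto_mult tendsto_of_real tendsto_vec_nth g tendsto_ident_at)
    then show "((\<lambda>s. (of_real s *s g s) $ i) \<longlongrightarrow> 0 $ i) (at_right 0)" by simp
  qed
  then have y0: "(y \<longlongrightarrow> 0) (at_right 0)"
    using tendsto_cong[OF y_g] by simp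
  have Cy0: "((\<lambda>s. ?C *v y s) \<longlongrightarrow> 0) (at_right 0)"
    using tendsto_matrix_vector_mult[OF y0, of ?C] by simp
  have "y s $ Inl 2 = v\<^sub>1 (y s $ Inl 1) (y s $ Inr 1) \<and> y s $ Inr 2 = v\<^sub>2 (y s $ Inl 1) (y s $ Inr 1)" for s
    by (simp add: y_def)
  then have yX: "\<forall>\<^sub>F s in at_right 0. y s \<in> X"
    using eventually_compose_filterlim[OF X_iff y0] by simp
  have ev: "\<forall>\<^sub>F s in at_right 0.
        (?C *v y s) $ Inl 2 = v\<^sub>1 ((?C *v y s) $ Inl 1) ((?C *v y s) $ Inr 1) \<and>
        (?C *v y s) $ Inr 2 = v\<^sub>2 ((?C *v y s) $ Inl 1) ((?C *v y s) $ Inr 1)"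
    using eventually_compose_filterlim[OF X_iff Cy0] eventually_compose_filterlim[OF X_inv y0] yX
    by eventually_elim simp
  have ev1: "\<forall>\<^sub>F s in at_right 0.
      (?C *v y s) $ Inl 2 / of_real s = v\<^sub>1 ((?C *v y s) $ Inl 1) ((?C *v y s) $ Inr 1) / of_real s"
    and ev2: "\<forall>\<^sub>F s in at_right 0.
      (?C *v y s) $ Inr 2 / of_real s = v\<^sub>2 ((?C *v y s) $ Inl 1) ((?C *v y s) $ Inr 1) / of_real s"
    using ev by (auto elim: eventually_mono)
  have nt: "at_right (0::real) \<noteq> bot" by simp
  \<comment> \<open>A second limit of the same quotient, now computed through
    \<open>v\<^sub>1\<close>; uniqueness of limits yields the linear equation.\<close>
  have "((\<lambda>s. (?C *v y s) $ Inl 2 / of_real s) \<longlongrightarrow> \<tau>\<^sub>1 * (?C *v w) $ Inl 1 + 0 * (?C *v w) $ Inr 1) (at_right 0)"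
    unfolding tendsto_cong[OF ev1] by (intro odd_series_tendsto v1 Cy)
  from tendsto_unique[OF nt Cy this]
  show "(?C *v w) $ Inl 2 = \<tau>\<^sub>1 * (?C *v w) $ Inl 1" by simp
  have "((\<lambda>s. (?C *v y s) $ Inr 2 / of_real s) \<longlongrightarrow> 0 * (?C *v w) $ Inl 1 + \<tau>\<^sub>2 * (?C *v w) $ Inr 1) (at_right 0)"
    unfolding tendsto_cong[OF ev2] by (intro odd_series_tendsto v2 Cy)
  from tendsto_unique[OF nt Cy this]
  show "(?C *v w) $ Inr 2 = \<tau>\<^sub>2 * (?C *v w) $ Inr 1" by simp
qed

section \<open>Automorphisms of Type II\<close>

text \<open>\<open>matrix_inv\<close> is a choice of two-sided inverse; uniqueness of inverses
  identifies it with any given one.\<close>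

lemma matrix_inv_eqI:
  fixes A B :: "'a::field^'n^'n"
  assumes "A ** B = mat 1"
  shows "matrix_inv A = B"
proof -
  have BA: "B ** A = mat 1" using assms matrix_left_right_inverse by blast
  have "\<exists>A'. A ** A' = mat 1 \<and> A' ** A = mat 1" using assms BA by blast
  then have "A ** matrix_inv A = mat 1"
    unfolding matrix_inv_def by (rule someI2_ex) simp
  then have "B ** (A ** matrix_inv A) = B" by simp
  then show ?thesis by (simp add: matrix_mul_assoc BA)
qed

text \<open>Rules out a minimal polynomial of degree one: a scalar matrix has zero off-diagonal
  blocks.\<close>

lemma cross_sum_not_scalar:
  assumes "det A \<noteq> 0"
  shows "cross_sum A B \<noteq> mat c"
proof
  assume "cross_sum A B = mat c"
  then have "A = 0" by (simp add: cross_sum_def mat_block[of c] block_matrix_eq_iff)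
  then show False using assms by (simp add: det_2)
qed

lemma cross_sum_inverse:
  fixes A B :: "'a::field^2^2"
  assumes "A ** B = mat 1" "det A \<noteq> 0"
  shows "is_min_poly (cross_sum A B) [:-1, 0, 1:]" "B = matrix_inv A"
proof -
  have BA: "B ** A = mat 1" using assms matrix_left_right_inverse by blast
  have "cross_sum A B ** cross_sum A B = mat 1"
    by (simp add: cross_sum_mult assms BA mat_block[of 1])
  then have "mat (-1) - mat 0 ** cross_sum A B + cross_sum A B ** cross_sum A B = 0"
    by (simp add: vec_eq_iff mat_mult_nth) (simp add: mat_def)
  from is_min_poly_quadratic[OF cross_sum_not_scalar[OF assms(2)] this]
  show "is_min_poly (cross_sum A B) [:-1, 0, 1:]" by simp
  show "B = matrix_inv A" using matrix_inv_eqI assms(1) by metis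
qed

lemma matrix_mult_minus_left: "(- A) ** B = - (A ** B)"
  for A :: "'a::ring_1^'n^'m" and B :: "'a^'k^'n"
  by (simp add: vec_eq_iff matrix_matrix_mult_def sum_negf)

lemma matrix_mult_minus_right: "A ** (- B) = - (A ** B)"
  for A :: "'a::ring_1^'n^'m" and B :: "'a^'k^'n"
  by (simp add: vec_eq_iff matrix_matrix_mult_def sum_negf)

lemma cross_sum_minus_inverse:
  fixes A B :: "'a::field^2^2"
  assumes "A ** B = - mat 1" "det A \<noteq> 0"
  shows "is_min_poly (cross_sum A B) [:1, 0, 1:]" "B = - matrix_inv A"
proof -
  have AB: "A ** (- B) = mat 1"
    by (simp add: matrix_mult_minus_right assms(1))
  then have "(- B) ** A = mat 1" using matrix_left_right_inverse by blast
  then have "- (B ** A) = mat 1" by (simp add: matrix_mult_minus_left)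
  then have BA: "B ** A = - mat 1" by (metis minus_minus)
  have "- mat 1 = (block_matrix (- mat 1) 0 0 (- mat 1) :: 'a^four^four)"
    by (simp add: vec_eq_iff split_sum_all block_matrix_nth mat_def)
  then have "cross_sum A B ** cross_sum A B = - mat 1"
    by (simp add: cross_sum_mult assms BA)
  then have "mat 1 - mat 0 ** cross_sum A B + cross_sum A B ** cross_sum A B = 0"
    by (simp add: vec_eq_iff mat_mult_nth)
  from is_min_poly_quadratic[OF cross_sum_not_scalar[OF assms(2)] this]
  show "is_min_poly (cross_sum A B) [:1, 0, 1:]" by simp
  show "B = - matrix_inv A" using matrix_inv_eqI[OF AB] by simp
qed

section \<open>Slopes of tangent lines under blocks of automorphisms\<close>

text \<open>\<open>A\<close> maps \<open>(1, \<sigma>)\<close> to a multiple of \<open>(1, \<tau>)\<close>.\<close>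

definition maps_slope :: "rat^2^2 \<Rightarrow> complex \<Rightarrow> complex \<Rightarrow> bool" where
  "maps_slope A \<sigma> \<tau> \<longleftrightarrow>
    of_rat (A$2$1) + of_rat (A$2$2) * \<sigma> = \<tau> * (of_rat (A$1$1) + of_rat (A$1$2) * \<sigma>)"

lemma maps_slope_mult:
  assumes "maps_slope A \<sigma> \<tau>" "maps_slope B \<rho> \<sigma>"
  shows "maps_slope (A ** B) \<rho> \<tau>"
proof -
  let ?a = "\<lambda>i j. complex_of_rat (A $ i $ j)" and ?b = "\<lambda>i j. complex_of_rat (B $ i $ j)"
  \<comment> \<open>\<open>B\<close> sends (1, \<rho>) to \<open>?k\<close> times (1, \<sigma>). The
    argument never divides by \<open>?k\<close>.\<close>
  let ?k = "?b 1 1 + ?b 1 2 * \<rho>"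
  have "of_rat ((A ** B)$2$1) + of_rat ((A ** B)$2$2) * \<rho> = ?a 2 1 * ?k + ?a 2 2 * (?b 2 1 + ?b 2 2 * \<rho>)"
    by (simp add: matrix_mult_2 of_rat_add of_rat_mult algebra_simps)
  also have "\<dots> = (?a 2 1 + ?a 2 2 * \<sigma>) * ?k"
    using assms(2) by (simp add: maps_slope_def algebra_simps)
  also have "\<dots> = \<tau> * ((?a 1 1 + ?a 1 2 * \<sigma>) * ?k)"
    using assms(1) by (simp add: maps_slope_def)
  also have "(?a 1 1 + ?a 1 2 * \<sigma>) * ?k = ?a 1 1 * ?k + ?a 1 2 * (?b 2 1 + ?b 2 2 * \<rho>)"
    using assms(2) by (simp add: maps_slope_def algebra_simps)
  also have "\<dots> = of_rat ((A ** B)$1$1) + of_rat ((A ** B)$1$2) * \<rho>"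
    by (simp add: matrix_mult_2 of_rat_add of_rat_mult algebra_simps)
  finally show ?thesis by (simp add: maps_slope_def)
qed

text \<open>The tangent space at the origin is spanned by \<open>w 1 0\<close> and
  \<open>w 0 1\<close>, one vector for each pair of coordinates. A cross sum swaps the pairs, so
  \<open>A\<close> is read off from \<open>w 0 1\<close> and \<open>B\<close> from
  \<open>w 1 0\<close>.\<close>

lemma Aut_cross_sum_maps_slope:
  assumes M: "cross_sum A B \<in> Aut X" and "cusp_shapes X \<tau>\<^sub>1 \<tau>\<^sub>2"
  shows "maps_slope A \<tau>\<^sub>2 \<tau>\<^sub>1" "maps_slope B \<tau>\<^sub>1 \<tau>\<^sub>2"
proof -
  obtain v\<^sub>1 v\<^sub>2 where X: "holonomy_presentation X \<tau>\<^sub>1 \<tau>\<^sub>2 v\<^sub>1 v\<^sub>2"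
    using assms(2) by (auto simp: cusp_shapes_def)
  define w :: "complex \<Rightarrow> complex \<Rightarrow> complex^four" where
    "w p q = (\<chi> i. case i of Inl r \<Rightarrow> if r = 1 then p else \<tau>\<^sub>1 * p
      | Inr r \<Rightarrow> if r = 1 then q else \<tau>\<^sub>2 * q)" for p q
  have w: "w p q $ Inl 2 = \<tau>\<^sub>1 * w p q $ Inl 1" "w p q $ Inr 2 = \<tau>\<^sub>2 * w p q $ Inr 1" for p q
    by (simp_all add: w_def)
  note simps = w_def complex_matrix_def cross_sum_def matrix_vector_mult_def sum_four sum_2 block_matrix_nth
  show "maps_slope A \<tau>\<^sub>2 \<tau>\<^sub>1"
    using Aut_preserves_tangent_space(1)[OF M X w, of 0 1] by (simp add: maps_slope_def simps)
  show "maps_slope B \<tau>\<^sub>1 \<tau>\<^sub>2"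
    using Aut_preserves_tangent_space(2)[OF M X w, of 1 0] by (simp add: maps_slope_def simps)
qed

lemma finite_powers_Aut:
  assumes "X \<in> Ghol" "M \<in> Aut X"
  shows "finite (range (matpow M))"
proof -
  have "matpow M k \<in> Aut X" for k
    using assms(2) by (induction k) (simp_all add: Aut_mat_1 Aut_mult)
  then have "range (matpow M) \<subseteq> Aut X" by blast
  then show ?thesis using finite_Aut[OF assms(1)] finite_subset by blast
qed

theorem theorem9p3:
  fixes X :: "(complex^four) set" and \<tau>\<^sub>1 \<tau>\<^sub>2 :: complex and K :: "complex set"
    and M :: "rat^four^four"
  assumes "X \<in> Ghol"
    and "cusp_shapes X \<tau>\<^sub>1 \<tau>\<^sub>2"
    and "quadratic_field K" and "\<tau>\<^sub>1 \<in> K" and "\<tau>\<^sub>2 \<in> K"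
    and "M \<in> Aut X"
    and "type_II M"
  shows
    "(is_min_poly M [:-1, 0, 1:] \<and>
        (\<exists>A\<^sub>2. invertible A\<^sub>2 \<and> M = cross_sum A\<^sub>2 (matrix_inv A\<^sub>2))) \<or>
     (is_min_poly M [:1, 0, 1:] \<and>
        (\<exists>A\<^sub>2. invertible A\<^sub>2 \<and> M = cross_sum A\<^sub>2 (- matrix_inv A\<^sub>2))) \<or>
     (is_min_poly M [:1, 0, 0, 0, 1:] \<and>
        (\<exists>A\<^sub>2 A\<^sub>3. invertible A\<^sub>2 \<and> invertible A\<^sub>3 \<and> M = cross_sum A\<^sub>2 A\<^sub>3 \<and>
           is_min_poly (A\<^sub>2 ** A\<^sub>3) [:1, 0, 1:]) \<and>
        \<tau>\<^sub>1 \<in> rat_adjoin (csqrt (-1)) \<and> \<tau>\<^sub>2 \<in> rat_adjoin (csqrt (-1))) \<or>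
     (is_min_poly M [:1, 0, 1, 0, 1:] \<and>
        (\<exists>A\<^sub>2 A\<^sub>3. invertible A\<^sub>2 \<and> invertible A\<^sub>3 \<and> M = cross_sum A\<^sub>2 A\<^sub>3 \<and>
           is_min_poly (A\<^sub>2 ** A\<^sub>3) [:1, 1, 1:]) \<and>
        \<tau>\<^sub>1 \<in> rat_adjoin (csqrt (-3)) \<and> \<tau>\<^sub>2 \<in> rat_adjoin (csqrt (-3))) \<or>
     (is_min_poly M [:1, 0, -1, 0, 1:] \<and>
        (\<exists>A\<^sub>2 A\<^sub>3. invertible A\<^sub>2 \<and> invertible A\<^sub>3 \<and> M = cross_sum A\<^sub>2 A\<^sub>3 \<and>
           is_min_poly (A\<^sub>2 ** A\<^sub>3) [:1, -1, 1:]) \<and>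
        \<tau>\<^sub>1 \<in> rat_adjoin (csqrt (-3)) \<and> \<tau>\<^sub>2 \<in> rat_adjoin (csqrt (-3)))"
proof -
  obtain A B where M: "M = cross_sum A B" and det: "det A = 1" "det B = 1"
    using assms(7) by (auto simp: type_II_def cross_sum_def)
  have inv: "invertible A" "invertible B" using det by (simp_all add: invertible_det_nz)
  have detAB: "det (A ** B) = 1" "det (B ** A) = 1" using det by (simp_all add: det_mul)
  have "finite (range (matpow (A ** B)))"
    using finite_powers_cross_sum finite_powers_Aut assms(1,6) unfolding M by blast
  then consider "A ** B = mat 1" | "A ** B = - mat 1" | "trace (A ** B) \<in> {-1, 0, 1}"
    using finite_powers_det_1_cases detAB(1) by blast
  then show ?thesis
  proof cases
    case 1
    then show ?thesis using cross_sum_inverse[OF 1] det inv M by auto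
  next
    case 2
    then show ?thesis using cross_sum_minus_inverse[OF 2] det inv M by auto
  next
    case 3
    have tr: "trace (B ** A) = trace (A ** B)" by (rule trace_mul_sym)
    \<comment> \<open>A scalar 2 by 2 matrix has squared trace four times its determinant, here 4,
      which these traces do not allow.\<close>
    have ns: "C \<noteq> mat c" if "det C = 1" "trace C \<in> {-1, 0, 1}" for C :: "rat^2^2" and c
    proof
      assume "C = mat c"
      then have "4 * det C = (trace C)\<^sup>2" by (simp add: det_2 trace_2 mat_def power2_eq_square)
      then show False using that by auto
    qed
    have ns': "A ** B \<noteq> mat c" "B ** A \<noteq> mat c" for c
      using ns detAB 3 tr by simp_all
    note polys = is_min_poly_cross_sum[OF ns'(1) inv(1), folded M] is_min_poly_2[OF ns'(1)]
    have slopes: "maps_slope A \<tau>\<^sub>2 \<tau>\<^sub>1" "maps_slope B \<tau>\<^sub>1 \<tau>\<^sub>2"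
      using Aut_cross_sum_maps_slope assms(2,6) unfolding M by blast+
    \<comment> \<open>\<open>B\<close> carries slope \<tau>\<open>\<^sub>1\<close> to
      \<tau>\<open>\<^sub>2\<close> and \<open>A\<close> carries it back, so both products have
      eigenvectors with cusp shapes as slopes.\<close>
    have slope: "maps_slope (A ** B) \<tau>\<^sub>1 \<tau>\<^sub>1" "maps_slope (B ** A) \<tau>\<^sub>2 \<tau>\<^sub>2"
      using slopes maps_slope_mult by blast+
    have nonreal: "\<tau>\<^sub>1 \<notin> \<real>" "\<tau>\<^sub>2 \<notin> \<real>"
      using assms(2) unfolding cusp_shapes_def holonomy_presentation_def by blast+
    \<comment> \<open>\<open>A ** B\<close> and \<open>B ** A\<close> have the same trace and
      determinant 1, so a single discriminant serves both cusp shapes.\<close>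
    have adjoin: "\<tau>\<^sub>1 \<in> rat_adjoin \<delta>" "\<tau>\<^sub>2 \<in> rat_adjoin \<delta>"
      if "(of_rat k * \<delta>)\<^sup>2 = of_rat ((trace (A ** B))\<^sup>2 - 4)" for k \<delta>
      using eigenvector_slope_in_rat_adjoin[OF ns'(1) nonreal(1), of k \<delta>]
        eigenvector_slope_in_rat_adjoin[OF ns'(2) nonreal(2), of k \<delta>] that slope
      by (simp_all add: maps_slope_def detAB tr)
    from 3 consider "trace (A ** B) = 0" | "trace (A ** B) = -1" | "trace (A ** B) = 1" by auto
    then show ?thesis
    proof cases
      case 1
      \<comment> \<open>The discriminant is -4, the square of twice
        \<open>csqrt (-1)\<close>.\<close>
      have "\<tau>\<^sub>1 \<in> rat_adjoin (csqrt (-1))" "\<tau>\<^sub>2 \<in> rat_adjoin (csqrt (-1))"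
        by (rule adjoin[of 2]; simp only: 1 power_mult_distrib power2_csqrt; simp)+
      moreover have "is_min_poly M [:1, 0, 0, 0, 1:]" "is_min_poly (A ** B) [:1, 0, 1:]"
        using polys by (simp_all add: 1 detAB)
      ultimately show ?thesis using inv M by blast
    next
      case 2
      \<comment> \<open>For trace 1 or -1 the discriminant is -3, with no square factor to
        remove.\<close>
      have "\<tau>\<^sub>1 \<in> rat_adjoin (csqrt (-3))" "\<tau>\<^sub>2 \<in> rat_adjoin (csqrt (-3))"
        by (rule adjoin[of 1]; simp only: 2 power_mult_distrib power2_csqrt; simp)+
      moreover have "is_min_poly M [:1, 0, 1, 0, 1:]" "is_min_poly (A ** B) [:1, 1, 1:]"
        using polys by (simp_all add: 2 detAB)
      ultimately show ?thesis using inv M by blast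
    next
      case 3
      have "\<tau>\<^sub>1 \<in> rat_adjoin (csqrt (-3))" "\<tau>\<^sub>2 \<in> rat_adjoin (csqrt (-3))"
        by (rule adjoin[of 1]; simp only: 3 power_mult_distrib power2_csqrt; simp)+
      moreover have "is_min_poly M [:1, 0, -1, 0, 1:]" "is_min_poly (A ** B) [:1, -1, 1:]"
        using polys by (simp_all add: 3 detAB)
      ultimately show ?thesis using inv M by blast
    qed
  qed
qed

end
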